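(* Let $p$ be an odd prime, $d,m\in\mathbb{N}$, and $e_1,\dots,e_d\in\mathbb{N}$ with $e_1\le e_2\le\cdots\le e_d$ and $p^{e_d}\ge 1+\sum_{i=1}^{d-1}(p^{e_i}-1)$. Let $G=C_{p^{e_1}}\times C_{p^{e_2}}\times\cdots\times C_{p^{e_{d-1}}}\times C_{m p^{e_d}}$. Then for every $r\in\mathbb{N}$, $$D_r(G)=r\,m\,p^{e_d}+\sum_{i=1}^{d-1}p^{e_i}-d+1.$$
   Context: All groups are finite abelian, written additively; $C_n$ is the cyclic group of order $n$. A sequence over $G$ is a finite multiset of elements of $G$; subsequences are sub-multisets; disjoint subsequences use distinct terms. A sequence is zero-sum if the sum of its terms is $0$. For $r\in\mathbb{N}$, $D_r(G)$ is the least positive integer $k$ such that every sequence over $G$ of length at least $k$ contains $r$ pairwise disjoint nonempty zero-sum subsequences. *)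

theory Defs
  imports
    "HOL-Algebra.FiniteProduct"
    "HOL-Algebra.Product_Groups"
    "HOL-Library.Multiset"
    "HOL-Computational_Algebra.Primes"
begin

text \<open>
  The groups of HOL-Algebra are written multiplicatively, so ``sum of the terms'' becomes a finite
  product in \<open>G\<close>. Sequences over \<open>G\<close> are multisets with all elements in \<open>carrier G\<close>.
\<close>

definition seq_over :: "('a, 'b) monoid_scheme \<Rightarrow> 'a multiset \<Rightarrow> bool" where
  "seq_over G S \<longleftrightarrow> set_mset S \<subseteq> carrier G"

definition seq_sum :: "('a, 'b) monoid_scheme \<Rightarrow> 'a multiset \<Rightarrow> 'a" where
  "seq_sum G S = finprod G (\<lambda>g. g [^]\<^bsub>G\<^esub> count S g) (set_mset S)"

definition zero_sum :: "('a, 'b) monoid_scheme \<Rightarrow> 'a multiset \<Rightarrow> bool" where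
  "zero_sum G S \<longleftrightarrow> seq_sum G S = \<one>\<^bsub>G\<^esub>"

text \<open>
  Disjointness of subsequences means that they use distinct terms of \<open>S\<close>, counted with
  multiplicity; hence it is their multiset sum that has to be contained in \<open>S\<close>.
\<close>

definition has_disjoint_zero_sums :: "('a, 'b) monoid_scheme \<Rightarrow> nat \<Rightarrow> 'a multiset \<Rightarrow> bool" where
  "has_disjoint_zero_sums G r S \<longleftrightarrow>
     (\<exists>T :: nat \<Rightarrow> 'a multiset.
        (\<forall>i<r. T i \<noteq> {#} \<and> zero_sum G (T i)) \<and> (\<Sum>i<r. T i) \<subseteq># S)"

definition Davenport :: "nat \<Rightarrow> ('a, 'b) monoid_scheme \<Rightarrow> nat" where
  "Davenport r G =
     (LEAST k. 0 < k \<and> (\<forall>S. seq_over G S \<and> k \<le> size S \<longrightarrow> has_disjoint_zero_sums G r S))"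

end

theory Submission
  imports Defs "HOL-Library.Disjoint_Sets"
begin

text \<open>
  Put \<open>q = p ^ e d\<close> and let \<open>s \<le> q - 1\<close> be the sum of the \<open>p ^ e i - 1\<close> for \<open>i < d\<close>. Let \<open>P\<close> be the quotient
  of \<open>G\<close> in which the last factor is replaced by \<open>C\<^sub>q\<close>. Olson's theorem for the \<open>p\<close>-groups \<open>P\<close> and
  \<open>P \<times> C\<^sub>q\<close> shows that a sequence of length at least \<open>2q + s\<close> has a zero-sum subsequence over \<open>P\<close> of
  length at most \<open>q\<close>, hence \<open>r m q + s\<close> terms contain \<open>r m\<close> disjoint zero-sum subsequences over \<open>P\<close>.
  Their sums lie in a cyclic group of order \<open>m\<close>, where any \<open>m\<close> terms have a zero-sum subsequence, so
  that they can be combined into \<open>r\<close> disjoint zero-sum subsequences over \<open>G\<close>.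
\<close>

section \<open>Polynomial set functions\<close>

text \<open>
  The monomials of degree at most \<open>k\<close> are the functions \<open>I \<mapsto> [A \<subseteq> I]\<close> with \<open>card A \<le> k\<close>: these are the
  products of the variables \<open>[a \<in> I]\<close>, \<open>a \<in> A\<close>, which are idempotent.
\<close>
inductive set_poly :: "nat \<Rightarrow> ('i set \<Rightarrow> rat) \<Rightarrow> bool" for k where
  zero: "set_poly k (\<lambda>_. 0)"
| add_monomial: "\<lbrakk>finite A; card A \<le> k; set_poly k f\<rbrakk>
    \<Longrightarrow> set_poly k (\<lambda>I. f I + (if A \<subseteq> I then c else 0))"

lemma set_poly_const: "set_poly k (\<lambda>_. c)"
  using set_poly.add_monomial[OF _ _ set_poly.zero, of "{}" k c] by simp

lemma set_poly_add: "set_poly k f \<Longrightarrow> set_poly k g \<Longrightarrow> set_poly k (\<lambda>I. f I + g I)"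
proof (induction rule: set_poly.induct)
  case (add_monomial A f c)
  then have "set_poly k (\<lambda>I. (f I + g I) + (if A \<subseteq> I then c else 0))"
    by (intro set_poly.add_monomial) auto
  then show ?case by (simp add: algebra_simps)
qed simp

lemma set_poly_sum: "(\<And>i. i \<in> V \<Longrightarrow> set_poly k (f i)) \<Longrightarrow> set_poly k (\<lambda>I. \<Sum>i\<in>V. f i I)"
  by (induction V rule: infinite_finite_induct) (auto intro: set_poly_add set_poly.zero)

lemma set_poly_mult_monomial:
  assumes "set_poly a f" "finite B" "card B \<le> b"
  shows "set_poly (a + b) (\<lambda>I. f I * (if B \<subseteq> I then c else 0))"
  using assms(1)
proof (induction rule: set_poly.induct)
  case zero
  then show ?case by (simp add: set_poly.zero)
next
  case (add_monomial A f c')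
  have "card (A \<union> B) \<le> a + b"
    using card_Un_le[of A B] add_monomial assms by linarith
  then have "set_poly (a + b)
      (\<lambda>I. f I * (if B \<subseteq> I then c else 0) + (if A \<union> B \<subseteq> I then c' * c else 0))"
    using add_monomial assms by (intro set_poly.add_monomial) auto
  moreover have "(\<lambda>I. f I * (if B \<subseteq> I then c else 0) + (if A \<union> B \<subseteq> I then c' * c else 0)) =
      (\<lambda>I. (f I + (if A \<subseteq> I then c' else 0)) * (if B \<subseteq> I then c else 0))"
    by (auto simp: fun_eq_iff algebra_simps)
  ultimately show ?case by simp
qed

lemma set_poly_mult:
  assumes "set_poly a f" "set_poly b g"
  shows "set_poly (a + b) (\<lambda>I. f I * g I)"
  using assms(2)
proof (induction rule: set_poly.induct)
  case zero
  then show ?case by (simp add: set_poly.zero)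
next
  case (add_monomial A g c)
  show ?case
    unfolding distrib_left
    by (intro set_poly_add add_monomial set_poly_mult_monomial assms(1))
qed

lemma set_poly_prod:
  "finite J \<Longrightarrow> (\<And>j. j \<in> J \<Longrightarrow> set_poly (k j) (f j)) \<Longrightarrow>
    set_poly (\<Sum>j\<in>J. k j) (\<lambda>I. \<Prod>j\<in>J. f j I)"
  by (induction J rule: finite_induct) (auto intro!: set_poly_mult set_poly_const)

text \<open>With \<open>y\<close> and \<open>c\<close> fixed, \<open>fact k\<close> times the
  binomial coefficient is a product of \<open>k\<close> factors, each of degree at most 1 in the
  indicator variables.\<close>

lemma set_poly_binomial:
  fixes y :: "'i \<Rightarrow> nat"
  assumes "finite V"
  shows "set_poly k (\<lambda>I. of_nat ((\<Sum>i\<in>V \<inter> I. y i) + c choose k))"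
proof -
  have lin: "set_poly 1 (\<lambda>I. of_nat ((\<Sum>i\<in>V \<inter> I. y i) + c) - of_nat l)" for l
  proof -
    have "set_poly 1 (\<lambda>I. (\<Sum>i\<in>V. 0 + (if {i} \<subseteq> I then rat_of_nat (y i) else 0)) +
        (of_nat c - of_nat l))"
      by (intro set_poly_add set_poly_sum set_poly.add_monomial set_poly.zero set_poly_const) auto
    also have "(\<lambda>I. (\<Sum>i\<in>V. 0 + (if {i} \<subseteq> I then rat_of_nat (y i) else 0)) +
        (of_nat c - of_nat l)) = (\<lambda>I. of_nat ((\<Sum>i\<in>V \<inter> I. y i) + c) - of_nat l)"
      using assms by (simp add: fun_eq_iff sum.inter_restrict if_distrib cong: if_cong)
    finally show ?thesis .
  qed
  have "set_poly ((\<Sum>l\<in>{0..<k}. 1) + 0) (\<lambda>I. (\<Prod>l\<in>{0..<k}.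
      of_nat ((\<Sum>i\<in>V \<inter> I. y i) + c) - of_nat l) * (1 / fact k))"
    by (intro set_poly_mult set_poly_prod lin set_poly_const) auto
  then show ?thesis
    by (simp add: binomial_gbinomial gbinomial_prod_rev)
qed

section \<open>Alternating sums over a power set\<close>

lemma sum_Pow_insert:
  assumes "finite W" "v \<notin> W"
  shows "(\<Sum>I\<in>Pow (insert v W). g I) = (\<Sum>I\<in>Pow W. g I + g (insert v I))"
proof -
  have "inj_on (insert v) (Pow W)"
    using assms(2) by (auto simp: inj_on_def)
  moreover have "Pow W \<inter> insert v ` Pow W = {}"
    using assms(2) by auto
  ultimately show ?thesis
    using assms(1) by (simp add: Pow_insert sum.union_disjoint sum.reindex sum.distrib)
qed

text \<open>Some \<open>v\<close> in \<open>V\<close> lies outside \<open>A\<close>. Adding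
  \<open>v\<close> to a set \<open>I\<close> does not affect \<open>A \<subseteq> I\<close> but
  flips the sign, so the terms cancel in pairs.\<close>

lemma alternating_sum_monomial:
  fixes c :: "'a :: comm_ring_1"
  assumes "finite V" "finite A" "card A < card V"
  shows "(\<Sum>I\<in>Pow V. (-1) ^ card I * (if A \<subseteq> I then c else 0)) = 0"
proof -
  obtain v where v: "v \<in> V" "v \<notin> A"
    using assms by (meson card_mono leD subsetI)
  have "(\<Sum>I\<in>Pow (insert v (V - {v})). (-1) ^ card I * (if A \<subseteq> I then c else 0)) = 0"
  proof (subst sum_Pow_insert, goal_cases)
    case 3
    show ?case
    proof (rule sum.neutral, safe)
      fix I assume "I \<subseteq> V - {v}"
      then have "card (insert v I) = Suc (card I)" "A \<subseteq> insert v I \<longleftrightarrow> A \<subseteq> I"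
        using assms v by (auto intro!: card_insert_disjoint dest: finite_subset)
      then show "(-1) ^ card I * (if A \<subseteq> I then c else 0) +
          (-1) ^ card (insert v I) * (if A \<subseteq> insert v I then c else 0) = 0"
        by simp
    qed
  qed (use assms in auto)
  then show ?thesis
    using v by (simp add: insert_absorb)
qed

lemma alternating_sum_set_poly:
  assumes "set_poly k f" "finite V" "k < card V"
  shows "(\<Sum>I\<in>Pow V. (-1) ^ card I * f I) = 0"
  using assms(1)
proof (induction rule: set_poly.induct)
  case (add_monomial A f c)
  then have "(\<Sum>I\<in>Pow V. (-1) ^ card I * (if A \<subseteq> I then c else 0)) = 0"
    using assms by (intro alternating_sum_monomial) auto
  then show ?case
    unfolding distrib_left sum.distrib using add_monomial by simp
qed simp

section \<open>Zero-sum index sets\<close>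

text \<open>Put \<open>q = p ^ f\<close>. By absorption, \<open>q\<close> divides
  \<open>n + q\<close> times the binomial coefficient. If \<open>p\<close> did not divide the
  latter, \<open>q\<close> would be coprime to it and hence divide \<open>n\<close>.\<close>

lemma prime_dvd_binomial_prime_power:
  fixes p n f :: nat
  assumes "prime p" "\<not> p ^ f dvd n"
  shows "p dvd (n + (p ^ f - 1) choose (p ^ f - 1))"
proof (rule ccontr)
  assume "\<not> p dvd (n + (p ^ f - 1) choose (p ^ f - 1))"
  then have "coprime (p ^ f) (n + (p ^ f - 1) choose (p ^ f - 1))"
    using assms(1) by (simp add: prime_imp_coprime)
  moreover have "p ^ f > 0"
    using assms(1) by (simp add: prime_gt_0_nat)
  then have "p ^ f * (n + p ^ f choose p ^ f) = (n + p ^ f) * (n + (p ^ f - 1) choose (p ^ f - 1))"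
    using times_binomial_minus1_eq[of "p ^ f" "n + p ^ f"] by (simp only: Nat.add_diff_assoc Suc_leI One_nat_def)
  then have "p ^ f dvd (n + p ^ f) * (n + (p ^ f - 1) choose (p ^ f - 1))"
    by (metis dvd_triv_left)
  ultimately show False
    using assms(2) by (simp add: coprime_dvd_mult_left_iff)
qed

text \<open>A sequence is encoded as an indexed family of integer coordinate vectors and a
  subsequence as an index set. Equal terms at different indices stay distinct, and disjointness
  becomes that of sets.\<close>

definition zero_sum_on :: "('j \<Rightarrow> nat) \<Rightarrow> 'j set \<Rightarrow> ('i \<Rightarrow> 'j \<Rightarrow> int) \<Rightarrow> 'i set \<Rightarrow> bool" where
  "zero_sum_on n J x I \<longleftrightarrow> (\<forall>j\<in>J. int (n j) dvd (\<Sum>i\<in>I. x i j))"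

lemma zero_sum_on_Diff:
  assumes "zero_sum_on n J x I" "zero_sum_on n J x I'" "I' \<subseteq> I" "finite I"
  shows "zero_sum_on n J x (I - I')"
  using assms by (simp add: zero_sum_on_def sum_diff)

text \<open>
  Olson's theorem. If only the empty set were zero-sum, then all terms except the one of the empty
  set would vanish modulo \<open>p\<close> in the alternating sum over \<open>Pow V\<close> of the polynomial
  \<open>\<Prod>j. s\<^sub>j + q\<^sub>j - 1 choose q\<^sub>j - 1\<close> in the coordinate sums \<open>s\<^sub>j\<close>, where \<open>q\<^sub>j = p ^ f j\<close>; but the
  alternating sum is \<open>0\<close> because the degree is less than \<open>card V\<close>.
\<close>
lemma olson:
  fixes p :: nat and f :: "'j \<Rightarrow> nat" and x :: "'i \<Rightarrow> 'j \<Rightarrow> int"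
  assumes p: "prime p" and J: "finite J" and V: "finite V"
    and card: "(\<Sum>j\<in>J. p ^ f j - 1) < card V"
  shows "\<exists>I\<subseteq>V. I \<noteq> {} \<and> zero_sum_on (\<lambda>j. p ^ f j) J x I"
proof (rule ccontr)
  assume none: "\<not> ?thesis"
  define q where "q j = p ^ f j" for j
  have q: "q j > 0" for j
    using p by (simp add: q_def prime_gt_0_nat)
  \<comment> \<open>Natural representatives of the residues, so that coordinate sums can enter
    binomial coefficients.\<close>
  define y where "y i j = nat (x i j mod int (q j))" for i j
  define F where "F I = (\<Prod>j\<in>J. (\<Sum>i\<in>V \<inter> I. y i j) + (q j - 1) choose (q j - 1))" for I
  have y: "q j dvd (\<Sum>i\<in>I. y i j) \<longleftrightarrow> int (q j) dvd (\<Sum>i\<in>I. x i j)" for I j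
  proof -
    have "int (\<Sum>i\<in>I. y i j) = (\<Sum>i\<in>I. x i j mod int (q j))"
      using q by (simp add: y_def)
    then have "int (\<Sum>i\<in>I. y i j) mod int (q j) = (\<Sum>i\<in>I. x i j) mod int (q j)"
      by (simp add: mod_sum_eq)
    then show ?thesis
      by (metis int_dvd_int_iff dvd_eq_mod_eq_0)
  qed
  have dvd: "int p dvd int (F I)" if "I \<subseteq> V" "I \<noteq> {}" for I
  proof -
    have "\<not> zero_sum_on q J x I"
      using none that unfolding q_def by blast
    then obtain j where j: "j \<in> J" "\<not> q j dvd (\<Sum>i\<in>I. y i j)"
      using y by (auto simp: zero_sum_on_def)
    then have "\<not> q j dvd (\<Sum>i\<in>V \<inter> I. y i j)"
      using that by (simp add: Int_absorb1)
    then have "p dvd (\<Sum>i\<in>V \<inter> I. y i j) + (q j - 1) choose (q j - 1)"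
      using prime_dvd_binomial_prime_power[OF p] by (simp add: q_def)
    then have "p dvd F I"
      unfolding F_def using J j(1) by (meson dvd_prodI dvd_trans)
    then show ?thesis by simp
  qed
  have "set_poly (\<Sum>j\<in>J. q j - 1) (\<lambda>I. \<Prod>j\<in>J.
      rat_of_nat ((\<Sum>i\<in>V \<inter> I. y i j) + (q j - 1) choose (q j - 1)))"
    by (intro set_poly_prod set_poly_binomial J V)
  then have "set_poly (\<Sum>j\<in>J. q j - 1) (\<lambda>I. rat_of_nat (F I))"
    by (simp add: F_def)
  then have "(\<Sum>I\<in>Pow V. (-1) ^ card I * rat_of_nat (F I)) = 0"
    using card V by (intro alternating_sum_set_poly) (auto simp: q_def)
  \<comment> \<open>Rational coefficients were forced by the factor \<open>1 / fact k\<close>; the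
    values are integers, and divisibility by \<open>p\<close> makes sense only for these.\<close>
  then have "rat_of_int (\<Sum>I\<in>Pow V. (-1) ^ card I * int (F I)) = 0"
    by simp
  then have "(\<Sum>I\<in>Pow V. (-1) ^ card I * int (F I)) = 0"
    by (simp only: of_int_eq_0_iff)
  moreover have "(\<Sum>I\<in>Pow V. (-1) ^ card I * int (F I)) =
      int (F {}) + (\<Sum>I\<in>Pow V - {{}}. (-1) ^ card I * int (F I))"
    using V by (subst sum.remove[of _ "{}"]) auto
  moreover have "F {} = 1"
    by (simp add: F_def)
  moreover have "int p dvd (\<Sum>I\<in>Pow V - {{}}. (-1) ^ card I * int (F I))"
    using dvd by (intro dvd_sum dvd_mult) auto
  ultimately have "int p dvd 1"
    by (metis dvd_0_right dvd_add_left_iff of_nat_1)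
  then show False
    using p by auto
qed

text \<open>
  Adjoining a coordinate that is constantly \<open>1\<close> forces the size of a zero-sum set to be \<open>q\<close> or \<open>2q\<close>,
  and a zero-sum set of size \<open>2q\<close> is long enough to be split further.
\<close>
lemma short_zero_sum:
  fixes p h :: nat and f :: "'j \<Rightarrow> nat" and x :: "'i \<Rightarrow> 'j \<Rightarrow> int"
  assumes p: "prime p" and J: "finite J" and V: "finite V"
    and small: "(\<Sum>j\<in>J. p ^ f j - 1) \<le> 2 * (p ^ h - 1)"
    and card: "(\<Sum>j\<in>J. p ^ f j - 1) + p ^ h \<le> card V"
  shows "\<exists>I\<subseteq>V. I \<noteq> {} \<and> zero_sum_on (\<lambda>j. p ^ f j) J x I \<and> card I \<le> p ^ h"
proof -
  define q where "q = p ^ h"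
  have q: "q > 0"
    using p by (simp add: q_def prime_gt_0_nat)
  let ?s = "\<Sum>j\<in>J. p ^ f j - 1"
  \<comment> \<open>Cutting down to exactly \<open>?s + q\<close> indices will keep
    \<open>card I\<close> below \<open>3 * q\<close>.\<close>
  obtain W where W: "W \<subseteq> V" "card W = ?s + q" "finite W"
    using card by (metis q_def obtain_subset_with_card_n)
  define f' where "f' = case_option h f"
  define x' where "x' i = case_option 1 (x i)" for i
  let ?J = "insert None (Some ` J)"
  have "(\<Sum>j\<in>?J. p ^ f' j - 1) = (q - 1) + ?s"
    using J by (simp add: sum.reindex f'_def q_def)
  then have "(\<Sum>j\<in>?J. p ^ f' j - 1) < card W"
    using W q by simp
  then obtain I where I: "I \<subseteq> W" "I \<noteq> {}" "zero_sum_on (\<lambda>j. p ^ f' j) ?J x' I"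
    using olson[OF p _ W(3), of ?J f' x'] J by auto
  have finI: "finite I"
    using I W finite_subset by blast
  have zs: "zero_sum_on (\<lambda>j. p ^ f j) J x I"
    using I(3) by (simp add: zero_sum_on_def f'_def x'_def)
  have "int q dvd int (card I)"
    using I(3) by (simp add: zero_sum_on_def f'_def x'_def q_def)
  then obtain c where c: "card I = q * c"
    unfolding int_dvd_int_iff by (elim dvdE)
  have "card I \<le> ?s + q"
    using I W by (metis card_mono)
  then have "q * c < q * 3"
    using c small q unfolding q_def by linarith
  then have "c < 3"
    by simp
  show ?thesis
  proof (cases "card I \<le> q")
    case True
    then show ?thesis
      using I W zs unfolding q_def by (meson order_trans)
  next
    case False
    with \<open>c < 3\<close> c have "c = 2"
      by (cases "c = 0 \<or> c = 1") auto
    with c have card2: "card I = 2 * q"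
      by simp
    \<comment> \<open>Leaving out \<open>i\<close> makes \<open>I'\<close> a proper subset, so
      \<open>I - I'\<close> is nonempty as well; one of the two has at most \<open>q\<close>
      elements.\<close>
    obtain i where i: "i \<in> I"
      using I by blast
    have "?s < 2 * q - 1"
      using small q unfolding q_def by linarith
    then have "?s < card (I - {i})"
      using card2 i finI by simp
    then obtain I' where I': "I' \<subseteq> I - {i}" "I' \<noteq> {}" "zero_sum_on (\<lambda>j. p ^ f j) J x I'"
      using olson[OF p J, of "I - {i}"] finI by blast
    have "card (I - I') = card I - card I'"
      using I' finI by (intro card_Diff_subset) (auto intro: finite_subset)
    then have "card I' \<le> q \<or> card (I - I') \<le> q"
      using card2 by linarith
    moreover have "zero_sum_on (\<lambda>j. p ^ f j) J x (I - I')"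
      using I' finI zs by (intro zero_sum_on_Diff) auto
    moreover have "I - I' \<noteq> {}"
      using i I' by blast
    moreover have "I' \<subseteq> V" "I - I' \<subseteq> V"
      using I W I' by auto
    ultimately show ?thesis
      using I' unfolding q_def by blast
  qed
qed

text \<open>Among the \<open>m + 1\<close> partial sums of \<open>m\<close> terms, two agree modulo
  \<open>m\<close>; the block of terms between them is the required set.\<close>

lemma zero_sum_on_cyclic:
  fixes x :: "'i \<Rightarrow> int"
  assumes "finite V" "0 < m" "m \<le> card V"
  shows "\<exists>I\<subseteq>V. I \<noteq> {} \<and> int m dvd (\<Sum>i\<in>I. x i) \<and> card I \<le> m"
proof -
  obtain W where W: "W \<subseteq> V" "card W = m" "finite W"
    using assms by (metis obtain_subset_with_card_n)
  then obtain g where g: "bij_betw g {..<m} W"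
    using ex_bij_betw_nat_finite by (metis atLeast0LessThan)
  define s where "s k = (\<Sum>i<k. x (g i)) mod int m" for k
  have "s ` {..m} \<subseteq> {0..<int m}"
    using assms by (auto simp: s_def)
  then have "card (s ` {..m}) \<le> card {0..<int m}"
    by (intro card_mono) auto
  then have "card (s ` {..m}) < card {..m}"
    by simp
  then obtain a b where ab: "a < b" "b \<le> m" "s a = s b"
    by (metis (no_types, opaque_lifting) atMost_iff inj_onI nat_neq_iff pigeonhole)
  have "(\<Sum>i<b. x (g i)) = (\<Sum>i<a. x (g i)) + (\<Sum>i\<in>{a..<b}. x (g i))"
    using ab by (simp add: atLeast0LessThan[symmetric] sum.atLeastLessThan_concat)
  then have dvd: "int m dvd (\<Sum>i\<in>{a..<b}. x (g i))"
    using ab(3) by (simp add: s_def mod_eq_dvd_iff)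
  have sub: "{a..<b} \<subseteq> {..<m}"
    using ab by auto
  then have inj: "inj_on g {a..<b}"
    using g by (meson bij_betw_def inj_on_subset)
  have "g ` {a..<b} \<subseteq> W"
    using g sub by (auto simp: bij_betw_def)
  moreover from this have "card (g ` {a..<b}) \<le> m"
    using W by (metis card_mono)
  moreover have "int m dvd (\<Sum>i\<in>g ` {a..<b}. x i)"
    using dvd inj by (simp add: sum.reindex)
  ultimately show ?thesis
    using W ab by (intro exI[of _ "g ` {a..<b}"]) auto
qed

section \<open>Greedy extraction of disjoint zero-sum sets\<close>

definition disjoint_subsets :: "('i set \<Rightarrow> bool) \<Rightarrow> nat \<Rightarrow> 'i set \<Rightarrow> bool" where
  "disjoint_subsets P r V \<longleftrightarrow> (\<exists>T :: nat \<Rightarrow> 'i set.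
     (\<forall>i<r. T i \<noteq> {} \<and> T i \<subseteq> V \<and> P (T i)) \<and> disjoint_family_on T {..<r})"

text \<open>Each removed set costs at most \<open>n\<close> elements. Only for the last set can
  fewer than \<open>2 * n + s\<close> elements be left, and its size no longer matters, so
  \<open>one\<close> suffices there.\<close>

lemma greedy_disjoint_subsets:
  assumes one: "\<And>W. W \<subseteq> V \<Longrightarrow> n + s \<le> card W \<Longrightarrow> \<exists>I\<subseteq>W. I \<noteq> {} \<and> P I"
    and short: "\<And>W. W \<subseteq> V \<Longrightarrow> 2 * n + s \<le> card W \<Longrightarrow> \<exists>I\<subseteq>W. I \<noteq> {} \<and> P I \<and> card I \<le> n"
    and V: "finite V"
  shows "W \<subseteq> V \<Longrightarrow> r * n + s \<le> card W \<Longrightarrow> disjoint_subsets P r W"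
proof (induction r arbitrary: W)
  case 0
  then show ?case by (simp add: disjoint_subsets_def disjoint_family_on_def)
next
  case (Suc r)
  show ?case
  proof (cases "r = 0")
    case True
    then obtain I where "I \<subseteq> W" "I \<noteq> {}" "P I"
      using one[of W] Suc by auto
    then show ?thesis
      unfolding disjoint_subsets_def using True
      by (intro exI[of _ "\<lambda>_. I"]) (auto simp: disjoint_family_on_def)
  next
    case False
    then have "2 * n \<le> Suc r * n"
      by (intro mult_right_mono) auto
    then obtain I where I: "I \<subseteq> W" "I \<noteq> {}" "P I" "card I \<le> n"
      using short[of W] Suc.prems by (meson add_le_mono1 le_trans)
    have "card (W - I) = card W - card I"
      using I Suc.prems V by (meson card_Diff_subset finite_subset)
    then have "r * n + s \<le> card (W - I)"
      using I Suc.prems by simp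
    then have "disjoint_subsets P r (W - I)"
      using Suc by (intro Suc.IH) auto
    then obtain T where T: "\<And>i. i < r \<Longrightarrow> T i \<noteq> {} \<and> T i \<subseteq> W - I \<and> P (T i)"
      and disj: "disjoint_family_on T {..<r}"
      unfolding disjoint_subsets_def by blast
    have "disjoint_family_on (T(r := I)) {..<Suc r}"
      unfolding disjoint_family_on_def
    proof (intro ballI impI)
      fix i j assume ij: "i \<in> {..<Suc r}" "j \<in> {..<Suc r}" "i \<noteq> j"
      then consider "i < r" "j < r" | "i = r" "j < r" | "i < r" "j = r"
        by fastforce
      then show "(T(r := I)) i \<inter> (T(r := I)) j = {}"
        using T disj ij by cases (fastforce simp: disjoint_family_on_def)+
    qed
    moreover have "\<forall>i<Suc r. (T(r := I)) i \<noteq> {} \<and> (T(r := I)) i \<subseteq> W \<and> P ((T(r := I)) i)"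
      using T I by (auto simp: less_Suc_eq)
    ultimately show ?thesis
      unfolding disjoint_subsets_def by blast
  qed
qed

lemma disjoint_zero_sums_upper:
  fixes p d m r :: nat and e :: "nat \<Rightarrow> nat" and x :: "'i \<Rightarrow> nat \<Rightarrow> int"
  assumes p: "prime p" and d: "1 \<le> d" and m: "1 \<le> m" and V: "finite V"
    and small: "(\<Sum>j\<in>{1..<d}. p ^ e j - 1) \<le> p ^ e d - 1"
    and card: "r * m * p ^ e d + (\<Sum>j\<in>{1..<d}. p ^ e j - 1) \<le> card V"
  shows "disjoint_subsets
    (zero_sum_on (\<lambda>i. if i < d then p ^ e i else m * p ^ e d) {1..d} x) r V"
proof -
  define q where "q = p ^ e d"
  have q: "q > 0"
    using p by (simp add: q_def prime_gt_0_nat)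
  define s where "s = (\<Sum>j\<in>{1..<d}. p ^ e j - 1)"
  have D: "{1..d} = insert d {1..<d}"
    using d by auto
  then have sum: "(\<Sum>j\<in>{1..d}. p ^ e j - 1) = (q - 1) + s"
    by (simp add: q_def s_def)
  have fin: "finite W" if "W \<subseteq> V" for W
    using V that finite_subset by blast
  \<comment> \<open>First extraction, modulo \<open>p ^ e j\<close> in every coordinate. The
    hypothesis \<open>small\<close> gives \<open>(q - 1) + s \<le> 2 * (q - 1)\<close>, as
    \<open>short_zero_sum\<close> demands.\<close>
  have "disjoint_subsets (zero_sum_on (\<lambda>j. p ^ e j) {1..d} x) (r * m) V"
  proof (rule greedy_disjoint_subsets[of V q s _ V])
    fix W assume "W \<subseteq> V" "q + s \<le> card W"
    then show "\<exists>I\<subseteq>W. I \<noteq> {} \<and> zero_sum_on (\<lambda>j. p ^ e j) {1..d} x I"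
      using q sum fin by (intro olson[OF p]) auto
  next
    fix W assume "W \<subseteq> V" "2 * q + s \<le> card W"
    then show "\<exists>I\<subseteq>W. I \<noteq> {} \<and> zero_sum_on (\<lambda>j. p ^ e j) {1..d} x I \<and> card I \<le> q"
      using q sum fin small unfolding q_def s_def
      by (intro short_zero_sum[OF p]) auto
  qed (use card V in \<open>auto simp: q_def s_def\<close>)
  then obtain T where
    T: "\<And>i. i < r * m \<Longrightarrow> T i \<noteq> {} \<and> T i \<subseteq> V \<and> zero_sum_on (\<lambda>j. p ^ e j) {1..d} x (T i)"
    and disjT: "disjoint_family_on T {..<r * m}"
    unfolding disjoint_subsets_def by blast
  \<comment> \<open>The last coordinate of \<open>T b\<close> sums to a multiple of
    \<open>q\<close>; the quotient modulo \<open>m\<close> is the obstruction to being zero-sum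
    modulo \<open>m * q\<close>.\<close>
  define y where "y b = (\<Sum>i\<in>T b. x i d) div int q" for b
  have y: "(\<Sum>i\<in>T b. x i d) = int q * y b" if "b < r * m" for b
    using T[OF that] d by (auto simp: y_def zero_sum_on_def q_def)
  \<comment> \<open>Second extraction, now among the \<open>r * m\<close> sets themselves, with
    slack 0.\<close>
  have "disjoint_subsets (\<lambda>B. int m dvd (\<Sum>b\<in>B. y b)) r {..<r * m}"
  proof (rule greedy_disjoint_subsets[of "{..<r * m}" m 0 _ "{..<r * m}"])
    fix W assume "W \<subseteq> {..<r * m}" "m + 0 \<le> card W"
    then show "\<exists>I\<subseteq>W. I \<noteq> {} \<and> int m dvd (\<Sum>b\<in>I. y b)"
      using zero_sum_on_cyclic[of W m y] m by (meson add_leD1 finite_lessThan finite_subset less_le_trans zero_less_one)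
  next
    fix W assume "W \<subseteq> {..<r * m}" "2 * m + 0 \<le> card W"
    then show "\<exists>I\<subseteq>W. I \<noteq> {} \<and> int m dvd (\<Sum>b\<in>I. y b) \<and> card I \<le> m"
      using m by (intro zero_sum_on_cyclic) (auto intro: finite_subset)
  qed auto
  then obtain B where
    B: "\<And>t. t < r \<Longrightarrow> B t \<noteq> {} \<and> B t \<subseteq> {..<r * m} \<and> int m dvd (\<Sum>b\<in>B t. y b)"
    and disjB: "disjoint_family_on B {..<r}"
    unfolding disjoint_subsets_def by blast
  have sumU: "(\<Sum>i\<in>\<Union> (T ` B t). x i j) = (\<Sum>b\<in>B t. \<Sum>i\<in>T b. x i j)" if "t < r" for t j
  proof (rule sum.UNION_disjoint)
    show "finite (B t)"
      using B[OF that] finite_subset by blast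
    show "\<forall>b\<in>B t. finite (T b)"
      using B[OF that] T fin by blast
    show "\<forall>a\<in>B t. \<forall>b\<in>B t. a \<noteq> b \<longrightarrow> T a \<inter> T b = {}"
      using B[OF that] disjT unfolding disjoint_family_on_def by blast
  qed
  have "zero_sum_on (\<lambda>i. if i < d then p ^ e i else m * p ^ e d) {1..d} x (\<Union> (T ` B t))"
    if t: "t < r" for t
    unfolding zero_sum_on_def
  proof
    fix j assume j: "j \<in> {1..d}"
    show "int (if j < d then p ^ e j else m * p ^ e d) dvd (\<Sum>i\<in>\<Union> (T ` B t). x i j)"
    proof (cases "j < d")
      case True
      have "int (p ^ e j) dvd (\<Sum>b\<in>B t. \<Sum>i\<in>T b. x i j)"
      proof (rule dvd_sum)
        fix b assume "b \<in> B t"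
        then have "zero_sum_on (\<lambda>j. p ^ e j) {1..d} x (T b)"
          using B[OF t] T by blast
        then show "int (p ^ e j) dvd (\<Sum>i\<in>T b. x i j)"
          using j unfolding zero_sum_on_def by blast
      qed
      then show ?thesis
        using True sumU[OF t] by simp
    next
      case False
      then have "j = d" using j by simp
      have "(\<Sum>b\<in>B t. \<Sum>i\<in>T b. x i d) = (\<Sum>b\<in>B t. int q * y b)"
        using B[OF t] y by (intro sum.cong) auto
      also have "\<dots> = int q * (\<Sum>b\<in>B t. y b)"
        by (simp add: sum_distrib_left)
      finally show ?thesis
        using B[OF t] sumU[OF t] \<open>j = d\<close> by (simp add: q_def mult.commute mult_dvd_mono)
    qed
  qed
  moreover have "\<Union> (T ` B t) \<noteq> {} \<and> \<Union> (T ` B t) \<subseteq> V" if "t < r" for t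
    using B[OF that] T by blast
  moreover have "disjoint_family_on (\<lambda>t. \<Union> (T ` B t)) {..<r}"
    unfolding disjoint_family_on_def
  proof (intro ballI impI)
    fix t u assume tu: "t \<in> {..<r}" "u \<in> {..<r}" "t \<noteq> u"
    have "T a \<inter> T b = {}" if "a \<in> B t" "b \<in> B u" for a b
    proof -
      have "a \<noteq> b" "a < r * m" "b < r * m"
        using that tu disjB B[of t] B[of u] by (auto simp: disjoint_family_on_def)
      then show ?thesis
        using disjT by (auto simp: disjoint_family_on_def)
    qed
    then show "\<Union> (T ` B t) \<inter> \<Union> (T ` B u) = {}"
      by blast
  qed
  ultimately show ?thesis
    unfolding disjoint_subsets_def by (intro exI[of _ "\<lambda>t. \<Union> (T ` B t)"]) simp
qed

section \<open>Sequences over products of cyclic groups\<close>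

lemma sum_mset_image_eq_sum_count:
  fixes h :: "'a \<Rightarrow> 'b :: comm_semiring_1"
  shows "(\<Sum>g\<in>#S. h g) = (\<Sum>g\<in>set_mset S. of_nat (count S g) * h g)"
proof -
  \<comment> \<open>A fixed finite superset \<open>A\<close> keeps the index set constant during the
    induction on \<open>S\<close>.\<close>
  have "(\<Sum>g\<in>#S. h g) = (\<Sum>g\<in>A. of_nat (count S g) * h g)"
    if "finite A" "set_mset S \<subseteq> A" for A
    using that(2)
  proof (induction S)
    case (add x S)
    have "(\<Sum>g\<in>A. of_nat (count (add_mset x S) g) * h g) =
        (\<Sum>g\<in>A. (if g = x then h x else 0) + of_nat (count S g) * h g)"
      by (intro sum.cong) (auto simp: algebra_simps)
    then show ?case
      using add that(1) by (simp add: sum.distrib)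
  qed simp
  then show ?thesis by blast
qed

text \<open>Positivity excludes \<open>integer_mod_group 0\<close>, the infinite cyclic group;
  elements are then tuples of reduced residues.\<close>

locale cyclic_product =
  fixes D :: "nat set" and n :: "nat \<Rightarrow> nat" and G :: "(nat \<Rightarrow> int) monoid"
  assumes n_pos: "\<And>i. i \<in> D \<Longrightarrow> 0 < n i"
    and G_eq: "G = product_group D (\<lambda>i. integer_mod_group (n i))"
begin

lemma comm_group_G: "comm_group G"
  unfolding G_eq
  by (intro group.group_comm_groupI) (auto simp: add.commute)

lemma pow_coord: "i \<in> D \<Longrightarrow> g \<in> carrier G \<Longrightarrow> (g [^]\<^bsub>G\<^esub> (k::nat)) i = (int k * g i) mod int (n i)"
  by (induction k) (auto simp: G_eq distrib_right mod_add_right_eq add.commute)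

lemma finprod_coord:
  assumes i: "i \<in> D" and "finite A" and "f \<in> A \<rightarrow> carrier G"
  shows "(finprod G f A) i = (\<Sum>a\<in>A. f a i) mod int (n i)"
proof -
  interpret comm_group G by (rule comm_group_G)
  show ?thesis
    using assms(2,3)
  proof (induction A rule: finite_induct)
    case empty
    have "\<one>\<^bsub>G\<^esub> i = 0"
      using i by (simp add: G_eq)
    then show ?case by simp
  next
    case (insert a A)
    then have "finprod G f (insert a A) = f a \<otimes>\<^bsub>G\<^esub> finprod G f A"
      by (intro finprod_insert) auto
    then have "(finprod G f (insert a A)) i = (f a i + (finprod G f A) i) mod int (n i)"
      using i by (simp add: G_eq)
    then show ?case
      using insert by (simp add: mod_add_right_eq)
  qed
qed

lemma seq_sum_coord:
  assumes "seq_over G S" "i \<in> D"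
  shows "seq_sum G S i = (\<Sum>g\<in>#S. g i) mod int (n i)"
proof -
  interpret comm_group G by (rule comm_group_G)
  have "seq_sum G S i = (\<Sum>g\<in>set_mset S. (g [^]\<^bsub>G\<^esub> count S g) i) mod int (n i)"
    unfolding seq_sum_def using assms by (intro finprod_coord) (auto simp: seq_over_def)
  also have "(\<Sum>g\<in>set_mset S. (g [^]\<^bsub>G\<^esub> count S g) i) =
      (\<Sum>g\<in>set_mset S. (int (count S g) * g i) mod int (n i))"
    using assms by (intro sum.cong) (auto simp: seq_over_def pow_coord)
  also have "(\<dots>) mod int (n i) = (\<Sum>g\<in>set_mset S. int (count S g) * g i) mod int (n i)"
    by (rule mod_sum_eq)
  also have "(\<Sum>g\<in>set_mset S. int (count S g) * g i) = (\<Sum>g\<in>#S. g i)"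
    by (simp add: sum_mset_image_eq_sum_count)
  finally show ?thesis .
qed

text \<open>Elements of the product are extensional, so being the identity is decided on the
  coordinates in \<open>D\<close>. This is the link to \<open>zero_sum_on\<close>.\<close>

lemma zero_sum_iff:
  assumes "seq_over G S"
  shows "zero_sum G S \<longleftrightarrow> (\<forall>i\<in>D. int (n i) dvd (\<Sum>g\<in>#S. g i))"
proof -
  interpret comm_group G by (rule comm_group_G)
  have "seq_sum G S \<in> carrier G"
    unfolding seq_sum_def using assms by (intro finprod_closed) (auto simp: seq_over_def)
  then have "zero_sum G S \<longleftrightarrow> (\<forall>i\<in>D. seq_sum G S i = 0)"
    unfolding zero_sum_def by (auto simp: G_eq PiE_def extensional_def fun_eq_iff)
  then show ?thesis
    using seq_sum_coord[OF assms] by (simp add: dvd_eq_mod_eq_0)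
qed

text \<open>Positions in a list serve as indices: disjoint position sets give multisets whose sum
  stays inside \<open>mset xs\<close>, multiplicities included.\<close>

lemma has_disjoint_zero_sums_nth:
  assumes "seq_over G (mset xs)"
    and "disjoint_subsets (zero_sum_on n D (nth xs)) r {..<length xs}"
  shows "has_disjoint_zero_sums G r (mset xs)"
proof -
  obtain T where
    T: "\<And>t. t < r \<Longrightarrow> T t \<noteq> {} \<and> T t \<subseteq> {..<length xs} \<and> zero_sum_on n D (nth xs) (T t)"
    and disj: "disjoint_family_on T {..<r}"
    using assms(2) unfolding disjoint_subsets_def by blast
  define M where "M t = image_mset (nth xs) (mset_set (T t))" for t
  have finT: "finite (T t)" if "t < r" for t
    using T[OF that] finite_subset by blast
  have all: "image_mset (nth xs) (mset_set {..<length xs}) = mset xs"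
  proof -
    have "mset (map (nth xs) [0..<length xs]) = mset xs"
      by (simp only: map_nth)
    then show ?thesis
      by (simp add: atLeast0LessThan)
  qed
  have union: "(\<Sum>t<k. M t) = image_mset (nth xs) (mset_set (\<Union>t<k. T t))" if "k \<le> r" for k
    using that
  proof (induction k)
    case (Suc k)
    have "T t \<inter> T k = {}" if "t < k" for t
      using disjoint_family_onD[OF disj, of t k] that Suc.prems by simp
    then have "(\<Union>t<k. T t) \<inter> T k = {}"
      by blast
    then have "mset_set ((\<Union>t<k. T t) \<union> T k) = mset_set (\<Union>t<k. T t) + mset_set (T k)"
      using finT Suc.prems by (intro mset_set_Union) auto
    then show ?case
      using Suc by (simp add: M_def lessThan_Suc Un_commute)
  qed simp
  have "(\<Union>t<r. T t) \<subseteq> {..<length xs}"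
    using T by blast
  then have "(\<Sum>t<r. M t) \<subseteq># mset xs"
    unfolding union[OF order_refl] all[symmetric]
    by (intro image_mset_subseteq_mono subset_imp_msubset_mset_set) auto
  moreover have "M t \<noteq> {#} \<and> zero_sum G (M t)" if t: "t < r" for t
  proof -
    have "set_mset (M t) \<subseteq> set xs"
      using T[OF t] finT[OF t] by (auto simp: M_def subset_iff)
    then have "seq_over G (M t)"
      using assms(1) by (auto simp: seq_over_def)
    moreover have "(\<Sum>g\<in>#M t. g i) = (\<Sum>k\<in>T t. (xs ! k) i)" for i
      by (simp add: M_def image_mset.compositionality comp_def sum_unfold_sum_mset)
    ultimately show ?thesis
      using T[OF t] finT[OF t] by (simp add: zero_sum_iff zero_sum_on_def M_def mset_set_empty_iff)
  qed
  ultimately show ?thesis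
    unfolding has_disjoint_zero_sums_def by blast
qed

section \<open>The extremal sequence for the lower bound\<close>

definition unit_vec :: "nat \<Rightarrow> nat \<Rightarrow> int" where
  "unit_vec i = (\<lambda>j\<in>D. if j = i then 1 else 0)"

lemma unit_vec_closed:
  assumes "i \<in> D" "1 < n i"
  shows "unit_vec i \<in> carrier G"
  using assms n_pos by (auto simp: unit_vec_def G_eq carrier_integer_mod_group)

lemma unit_vec_eq_iff: "i \<in> D \<Longrightarrow> unit_vec i = unit_vec j \<longleftrightarrow> i = j"
  by (auto simp: unit_vec_def fun_eq_iff restrict_def)

text \<open>Turns the zero-sum condition into divisibility of every multiplicity.\<close>

lemma sum_unit_vecs:
  assumes "set_mset T \<subseteq> unit_vec ` D" "j \<in> D"
  shows "(\<Sum>g\<in>#T. g j) = int (count T (unit_vec j))"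
  using assms(1)
proof (induction T)
  case (add g T)
  then obtain i where "i \<in> D" "g = unit_vec i" by auto
  then have "g j = (if g = unit_vec j then 1 else 0)"
    using assms(2) unit_vec_eq_iff[of i j] by (auto simp: unit_vec_def)
  then show ?case
    using add by auto
qed simp

text \<open>
  In the standard extremal sequence every zero-sum subsequence uses only copies of \<open>unit_vec z\<close>, at
  least \<open>n z\<close> of them.
\<close>
lemma unit_vec_sequence:
  assumes D: "finite D" "z \<in> D" and n: "\<And>i. i \<in> D \<Longrightarrow> 1 < n i" and r: "1 \<le> r"
  defines "S \<equiv> \<Sum>i\<in>D. replicate_mset (if i = z then r * n i - 1 else n i - 1) (unit_vec i)"
  shows "seq_over G S" and "\<not> has_disjoint_zero_sums G r S"
    and "size S = (r * n z - 1) + (\<Sum>i\<in>D - {z}. n i - 1)"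
proof -
  have set_S: "set_mset S \<subseteq> unit_vec ` D"
    using D by (auto simp: S_def set_mset_sum split: if_splits)
  then show over: "seq_over G S"
    using unit_vec_closed n by (auto simp: seq_over_def)
  show "size S = (r * n z - 1) + (\<Sum>i\<in>D - {z}. n i - 1)"
    using D by (simp add: S_def size_multiset_sum sum.remove[of D z])
  have count_S: "count S (unit_vec j) = (if j = z then r * n j - 1 else n j - 1)"
    if "j \<in> D" for j
  proof -
    have "count S (unit_vec j) = (\<Sum>i\<in>D. if i = j then (if j = z then r * n j - 1 else n j - 1) else 0)"
      unfolding S_def count_sum using that by (intro sum.cong) (auto simp: unit_vec_eq_iff)
    then show ?thesis
      using D that by simp
  qed
  show "\<not> has_disjoint_zero_sums G r S"
  proof
    assume "has_disjoint_zero_sums G r S"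
    then obtain T where T: "\<And>t. t < r \<Longrightarrow> T t \<noteq> {#} \<and> zero_sum G (T t)"
      and sub: "(\<Sum>t<r. T t) \<subseteq># S"
      unfolding has_disjoint_zero_sums_def by blast
    have "n z \<le> count (T t) (unit_vec z)" if t: "t < r" for t
    proof -
      have "T t \<subseteq># (\<Sum>t<r. T t)"
        using t by (simp add: sum.remove[of "{..<r}" t])
      then have TS: "T t \<subseteq># S"
        using sub by (rule subset_mset.order_trans)
      then have setT: "set_mset (T t) \<subseteq> unit_vec ` D"
        using set_S set_mset_mono by blast
      moreover have "seq_over G (T t)"
        using over TS set_mset_mono unfolding seq_over_def by blast
      ultimately have dvd: "n j dvd count (T t) (unit_vec j)" if "j \<in> D" for j
        using T[OF t] that by (auto simp: zero_sum_iff sum_unit_vecs)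
      \<comment> \<open>The multiplicity is divisible by \<open>n j\<close>, but only
        \<open>n j - 1\<close> copies are available.\<close>
      have "count (T t) (unit_vec j) = 0" if j: "j \<in> D" "j \<noteq> z" for j
      proof -
        have "count (T t) (unit_vec j) \<le> n j - 1"
          using TS count_S[OF j(1)] j(2) by (metis mset_subset_eq_count)
        then show ?thesis
          using dvd[OF j(1)] n[OF j(1)] dvd_imp_le[of "n j" "count (T t) (unit_vec j)"]
          by linarith
      qed
      then have "set_mset (T t) \<subseteq> {unit_vec z}"
        using setT by (fastforce simp: count_eq_zero_iff)
      then have "count (T t) (unit_vec z) > 0"
        using T[OF t] by (metis count_greater_zero_iff set_mset_eq_empty_iff subset_singletonD singletonI)
      then show ?thesis
        using dvd[OF D(2)] by (simp add: dvd_imp_le)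
    qed
    \<comment> \<open>Altogether \<open>r * n z\<close> copies of \<open>unit_vec z\<close> would be
      used, one more than \<open>S\<close> has.\<close>
    then have "(\<Sum>t<r. n z) \<le> (\<Sum>t<r. count (T t) (unit_vec z))"
      by (intro sum_mono) auto
    also have "\<dots> = count (\<Sum>t<r. T t) (unit_vec z)"
      by (simp add: count_sum)
    also have "\<dots> \<le> r * n z - 1"
      using mset_subset_eq_count[OF sub, of "unit_vec z"] count_S[OF D(2)] by simp
    finally have "r * n z \<le> r * n z - 1"
      by (simp only: sum_constant card_lessThan of_nat_id)
    moreover have "0 < r * n z"
      using n[OF D(2)] r by simp
    ultimately show False
      by linarith
  qed
qed

end

text \<open>A threshold \<open>l < k\<close> would satisfy \<open>l \<le> size S\<close> and so
  apply to the counterexample \<open>S\<close>.\<close>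

lemma Davenport_eqI:
  assumes "0 < k" and "\<And>S. seq_over G S \<Longrightarrow> k \<le> size S \<Longrightarrow> has_disjoint_zero_sums G r S"
    and "seq_over G S" "k \<le> Suc (size S)" "\<not> has_disjoint_zero_sums G r S"
  shows "Davenport r G = k"
  unfolding Davenport_def
proof (rule Least_equality)
  show "k \<le> l" if "0 < l \<and> (\<forall>S. seq_over G S \<and> l \<le> size S \<longrightarrow> has_disjoint_zero_sums G r S)" for l
    using that assms(3-5) by (meson not_less_eq_eq order_trans)
qed (use assms in auto)

theorem theorem4:
  fixes p d m r :: nat and e :: "nat \<Rightarrow> nat" and G :: "(nat \<Rightarrow> int) monoid"
  assumes "prime p" and "odd p"
    and "1 \<le> d" and "1 \<le> m"
    and "\<forall>i\<in>{1..d}. 1 \<le> e i"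
    and "mono_on {1..d} e"
    and "int (p ^ e d) \<ge> 1 + (\<Sum>i\<in>{1..<d}. (int (p ^ e i) - 1))"
    and "G = product_group {1..d}
               (\<lambda>i. integer_mod_group (if i < d then p ^ e i else m * p ^ e d))"
    and "1 \<le> r"
  shows "int (Davenport r G) =
           int (r * m * p ^ e d) + (\<Sum>i\<in>{1..<d}. int (p ^ e i)) - int d + 1"
proof -
  define n where "n i = (if i < d then p ^ e i else m * p ^ e d)" for i
  define s where "s = (\<Sum>i\<in>{1..<d}. p ^ e i - 1)"
  define k where "k = r * m * p ^ e d + s"
  have pow: "1 < p ^ e i" if "i \<in> {1..d}" for i
    using assms(1,5) that prime_gt_1_nat by (metis one_less_power less_le_trans zero_less_one)
  have n: "1 < n i" if "i \<in> {1..d}" for i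
    using pow[OF that] pow[of d] assms(3,4) that
    by (auto simp: n_def intro: less_le_trans)
  \<comment> \<open>Truncated subtraction agrees with integer subtraction here because the prime
    powers exceed 1.\<close>
  have s: "int s = (\<Sum>i\<in>{1..<d}. int (p ^ e i) - 1)"
    unfolding s_def of_nat_sum using pow by (intro sum.cong) (auto simp: of_nat_diff less_imp_le)
  interpret cyclic_product "{1..d}" n G
  proof
    show "0 < n i" if "i \<in> {1..d}" for i
      using n[OF that] by simp
  qed (simp add: assms(8) n_def)
  let ?S = "\<Sum>i\<in>{1..d}. replicate_mset (if i = d then r * n i - 1 else n i - 1) (unit_vec i)"
  have dD: "d \<in> {1..d}"
    using assms(3) by simp
  \<comment> \<open>Taking \<open>z = d\<close> puts the factor \<open>r\<close> on the largest
    cyclic factor and gives length \<open>k - 1\<close>.\<close>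
  note ex = unit_vec_sequence[OF finite_atLeastAtMost dD n assms(9)]
  have "{1..d} - {d} = {1..<d}"
    by auto
  then have "size ?S = (r * n d - 1) + s"
    using ex(3) by (simp add: n_def s_def)
  moreover have k: "k = r * n d + s" "0 < r * n d"
  proof -
    show "k = r * n d + s"
      by (simp add: k_def n_def mult.assoc)
    show "0 < r * n d"
      using n[OF dD] assms(9) by simp
  qed
  ultimately have size: "k \<le> Suc (size ?S)"
    by linarith
  have "has_disjoint_zero_sums G r S" if S: "seq_over G S" "k \<le> size S" for S
  proof -
    obtain xs where xs: "S = mset xs"
      using ex_mset by metis
    have "int s \<le> int (p ^ e d) - 1"
      using assms(7) s by simp
    then have "s \<le> p ^ e d - 1"
      by linarith
    then have "disjoint_subsets (zero_sum_on n {1..d} (nth xs)) r {..<length xs}"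
      unfolding n_def using S xs assms
      by (intro disjoint_zero_sums_upper) (auto simp: s_def k_def)
    then show ?thesis
      using S xs has_disjoint_zero_sums_nth by simp
  qed
  then have "Davenport r G = k"
    using k ex(1,2) size by (intro Davenport_eqI[where S = ?S]) auto
  \<comment> \<open>The \<open>d - 1\<close> subtracted ones in \<open>s\<close> account for the
    term \<open>- int d + 1\<close>.\<close>
  then show ?thesis
    using s assms(3) by (simp add: k_def sum_subtractf of_nat_diff)
qed

end
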